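(* Consider three mutually orthogonal product states $|\mathrm{Ppp}\rangle_{AB},|\mathrm{pPp}\rangle_{AB},|\mathrm{ppP}\rangle_{AB}$ in $\mathbb{C}^2\otimes\mathbb{C}^2$. When one product state is represented as $$|\mathrm{Ppp}\rangle_{AB}=|00\rangle_{AB},$$ the other product states are determined as $$|\mathrm{pPp}\rangle_{AB}=|\alpha_0\rangle_A\otimes|1\rangle_B,\qquad |\mathrm{ppP}\rangle_{AB}=|\alpha_1\rangle_A\otimes|1\rangle_B,$$ or $$|\mathrm{pPp}\rangle_{AB}=|1\rangle_A\otimes|\beta_0\rangle_B,\qquad |\mathrm{ppP}\rangle_{AB}=|1\rangle_A\otimes|\beta_1\rangle_B,$$ where $\{|\alpha_j\rangle_A\}$ and $\{|\beta_j\rangle_B\}$ denote arbitrary orthonormal bases of the qubit subsystems $A$ and $B$.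
   Context: $A$ and $B$ are qubit systems, each with state space $\mathbb{C}^2$ and standard basis $|0\rangle,|1\rangle$, and $|jk\rangle_{AB}=|j\rangle_A\otimes|k\rangle_B$. A state is a unit vector; a state in $\mathbb{C}^2\otimes\mathbb{C}^2$ is a product state if it equals $|u\rangle_A\otimes|v\rangle_B$ for some $|u\rangle,|v\rangle\in\mathbb{C}^2$. The names $|\mathrm{Ppp}\rangle,|\mathrm{pPp}\rangle,|\mathrm{ppP}\rangle$ denote the first, second and third state of the orthonormal set.
   Formalization: Which state is called Ppp is chosen suitably among the three, in suitable local bases; for an arbitrarily named first state the claim fails, e.g. for |00⟩, |01⟩, |1⟩(|0⟩+|1⟩)/√2. *)

theory Defs
  imports "HOL-Analysis.Analysis"
begin

text \<open>
  The library's inner product on \<^typ>\<open>complex ^ 'n\<close> is real-valued, hence the Hermitian one below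
  (conjugate-linear in the first argument). It induces the library's norm.
\<close>

definition cinner :: "complex ^ 'n \<Rightarrow> complex ^ 'n \<Rightarrow> complex" where
  "cinner x y = (\<Sum>i\<in>UNIV. cnj (x $ i) * y $ i)"

definition orthonormal_basis :: "('i \<Rightarrow> complex ^ 'n) \<Rightarrow> bool" where
  "orthonormal_basis b \<longleftrightarrow>
     (\<forall>i j. cinner (b i) (b j) = (if i = j then 1 else 0)) \<and> vec.span (range b) = UNIV"

text \<open>
  A qubit has state space \<^typ>\<open>complex ^ 2\<close>; the two elements of the index type \<^typ>\<open>2\<close> are written
  \<open>0\<close> and \<open>1\<close>. The tensor product of two qubits is \<^typ>\<open>complex ^ (2 \<times> 2)\<close>.
\<close>

definition ket :: "2 \<Rightarrow> complex ^ 2" where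
  "ket j = axis j 1"

definition tensor :: "complex ^ 2 \<Rightarrow> complex ^ 2 \<Rightarrow> complex ^ (2 \<times> 2)"  (infixr "\<otimes>" 75) where
  "u \<otimes> v = (\<chi> p. u $ fst p * v $ snd p)"

definition is_state :: "complex ^ 'n \<Rightarrow> bool" where
  "is_state \<psi> \<longleftrightarrow> norm \<psi> = 1"

definition is_product :: "complex ^ (2 \<times> 2) \<Rightarrow> bool" where
  "is_product \<psi> \<longleftrightarrow> (\<exists>u v. \<psi> = u \<otimes> v)"

definition orthogonal_product_states :: "(complex ^ (2 \<times> 2)) set \<Rightarrow> bool" where
  "orthogonal_product_states S \<longleftrightarrow>
     (\<forall>\<psi>\<in>S. is_state \<psi> \<and> is_product \<psi>) \<and> pairwise (\<lambda>\<phi> \<psi>. cinner \<phi> \<psi> = 0) S"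

text \<open>
  \<open>local_rep a b \<psi>\<close> is \<open>\<psi>\<close> represented in the local bases \<open>a\<close> and \<open>b\<close>: \<open>a j \<otimes> b k\<close> is represented as
  \<open>ket j \<otimes> ket k\<close>. For \<open>a = b = ket\<close> it is \<open>\<psi>\<close> itself.
\<close>

definition local_rep ::
  "(2 \<Rightarrow> complex ^ 2) \<Rightarrow> (2 \<Rightarrow> complex ^ 2) \<Rightarrow> complex ^ (2 \<times> 2) \<Rightarrow> complex ^ (2 \<times> 2)" where
  "local_rep a b \<psi> = (\<chi> p. cinner (a (fst p) \<otimes> b (snd p)) \<psi>)"

text \<open>
  Which member of a triple of orthogonal product states is represented as \<open>ket 0 \<otimes> ket 0\<close> cannot be
  prescribed: in the following triple it cannot be the first one.
\<close>

lemma UNIV_2': "(UNIV :: 2 set) = {0, 1}"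
  using UNIV_2 by auto

lemma first_state_not_prescribable:
  defines "P \<equiv> ket 0 \<otimes> ket 0" and "Q \<equiv> ket 0 \<otimes> ket 1"
    and "R \<equiv> ket 1 \<otimes> ((1 / sqrt 2) *\<^sub>R (ket 0 + ket 1))"
  shows "orthogonal_product_states {P, Q, R} \<and> card {P, Q, R} = 3 \<and>
    \<not> (\<exists>u v. Q = u \<otimes> ket 1 \<and> R = v \<otimes> ket 1) \<and>
    \<not> (\<exists>u v. Q = ket 1 \<otimes> u \<and> R = ket 1 \<otimes> v)"
proof -
  have U: "(UNIV :: (2 \<times> 2) set) = {(0,0),(0,1),(1,0),(1,1)}"
    unfolding UNIV_Times_UNIV[symmetric] UNIV_2' by auto
  have P: "P $ (0,0) = 1" "P $ (0,1) = 0" "P $ (1,0) = 0" "P $ (1,1) = 0"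
    and Q: "Q $ (0,0) = 0" "Q $ (0,1) = 1" "Q $ (1,0) = 0" "Q $ (1,1) = 0"
    and R: "R $ (0,0) = 0" "R $ (0,1) = 0" "R $ (1,0) = 1 / sqrt 2" "R $ (1,1) = 1 / sqrt 2"
    by (simp_all add: P_def Q_def R_def tensor_def ket_def axis_def scaleR_conv_of_real[of _ "_ :: complex"])
  have "is_state P" "is_state Q" "is_state R"
    by (simp_all add: is_state_def norm_vec_def L2_set_def U P Q R norm_divide power_divide)
  moreover have "is_product P" "is_product Q" "is_product R"
    by (auto simp: is_product_def P_def Q_def R_def)
  moreover have "cinner P Q = 0" "cinner Q P = 0" "cinner P R = 0" "cinner R P = 0"
    "cinner Q R = 0" "cinner R Q = 0"
    by (simp_all add: cinner_def U P Q R)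
  moreover have "P \<noteq> Q" "P \<noteq> R" "Q \<noteq> R"
    using P Q R by (metis zero_neq_one)+
  moreover have "R \<noteq> v \<otimes> ket 1" for v
    using R(3) by (auto simp: tensor_def ket_def axis_def)
  moreover have "Q \<noteq> ket 1 \<otimes> u" for u
    using Q(2) by (auto simp: tensor_def ket_def axis_def)
  ultimately show ?thesis
    by (auto simp: orthogonal_product_states_def pairwise_def)
qed

end

theory Submission
  imports Defs
begin

text \<open>
  Two product states are orthogonal iff their \<open>A\<close> factors or their \<open>B\<close> factors are. Among the three
  pairs of a triple, two are therefore orthogonal through the same subsystem, say \<open>A\<close>; these pairs
  share a state, and that state is taken as \<open>Ppp\<close>. The \<open>A\<close> factors of the other two states lie in the
  orthogonal complement of the \<open>A\<close> factor of \<open>Ppp\<close>, which is a line because \<open>A\<close> is a qubit, so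
  their \<open>B\<close> factors must be orthogonal. Passing to local bases that represent \<open>Ppp\<close> as
  \<open>ket 0 \<otimes> ket 0\<close> preserves the Hermitian products.
\<close>

section \<open>Hermitian products, kets and tensors\<close>

lemma cinner_commute: "cinner y x = cnj (cinner x y)"
  by (simp add: cinner_def mult.commute)

lemma cinner_self: "cinner x x = complex_of_real ((norm x)\<^sup>2)"
  by (simp add: cinner_def norm_vec_def L2_set_def sum_nonneg complex_norm_square mult.commute
      del: of_real_power)

text \<open>Turns normalisation into a statement about \<open>cinner\<close>, so that
  \<open>cinner_tensor\<close> and \<open>cinner_coords\<close> handle it in the same way as
  orthogonality.\<close>

lemma is_state_iff_cinner: "is_state x \<longleftrightarrow> cinner x x = 1"
proof -
  have "cinner x x = 1 \<longleftrightarrow> (norm x)\<^sup>2 = 1"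
    unfolding cinner_self by (rule of_real_eq_1_iff)
  then show ?thesis
    by (simp add: is_state_def power2_eq_1_iff) (metis norm_ge_zero not_one_le_zero neg_0_le_iff_le)
qed

lemma cinner_qubit: "cinner x y = cnj (x $ 0) * y $ 0 + cnj (x $ 1) * y $ 1" for x y :: "complex ^ 2"
  by (simp add: cinner_def UNIV_2')

lemma qubit_eq_iff: "x = y \<longleftrightarrow> x $ 0 = y $ 0 \<and> x $ 1 = y $ 1" for x y :: "complex ^ 2"
proof -
  have "(\<forall>i\<in>UNIV. x $ i = y $ i) \<longleftrightarrow> x $ 0 = y $ 0 \<and> x $ 1 = y $ 1"
    unfolding UNIV_2' by blast
  then show ?thesis by (simp add: vec_eq_iff)
qed

lemma ket_nth: "ket i $ j = (if i = j then 1 else 0)"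
  by (simp add: ket_def axis_def)

lemma cinner_ket: "cinner (ket i) (ket j) = (if i = j then 1 else 0)"
  by (cases "i = j") (auto simp: cinner_def ket_nth if_distrib cong: if_cong intro!: sum.neutral)

lemma tensor_nth: "(u \<otimes> v) $ (i, j) = u $ i * v $ j"
  by (simp add: tensor_def)

text \<open>The sum over index pairs factors into one sum per subsystem. Hence orthogonality of two
  product states means that one of the two factors vanishes.\<close>

lemma cinner_tensor: "cinner (u \<otimes> v) (u' \<otimes> v') = cinner u u' * cinner v v'"
  by (simp add: cinner_def tensor_def UNIV_Times_UNIV[symmetric] sum_product sum.cartesian_product
      case_prod_beta mult_ac del: UNIV_Times_UNIV)

text \<open>A scalar has no definite side in a product vector; this moves it to the side where it is
  wanted.\<close>

lemma tensor_scale_swap: "(c *s u) \<otimes> v = u \<otimes> (c *s v)"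
  by (simp add: tensor_def vec_eq_iff)

section \<open>Coordinates in an orthonormal basis\<close>

definition coords :: "('i \<Rightarrow> complex ^ 'n) \<Rightarrow> complex ^ 'n \<Rightarrow> complex ^ 'i" where
  "coords a x = (\<chi> i. cinner (a i) x)"

text \<open>Reduces the two-qubit representation to one coordinate map per subsystem.\<close>

lemma local_rep_tensor: "local_rep a b (u \<otimes> v) = coords a u \<otimes> coords b v"
  by (simp add: local_rep_def cinner_tensor vec_eq_iff tensor_nth coords_def)

text \<open>
  The matrix with rows \<open>cnj (a i)\<close> has its adjoint as right inverse, hence also as left inverse.
\<close>

lemma orthonormal_complete:
  fixes a :: "'n \<Rightarrow> complex ^ 'n"
  assumes "\<And>i j. cinner (a i) (a j) = (if i = j then 1 else 0)"
  shows "(\<Sum>i\<in>UNIV. a i $ k * cnj (a i $ l)) = (if k = l then 1 else 0)"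
proof -
  define M :: "complex ^ 'n ^ 'n" where "M = (\<chi> i j. cnj (a i $ j))"
  define N :: "complex ^ 'n ^ 'n" where "N = (\<chi> i j. a j $ i)"
  have "M ** N = mat 1"
    using assms by (simp add: M_def N_def matrix_matrix_mult_def mat_def vec_eq_iff cinner_def)
  then have "N ** M = mat 1"
    by (simp add: matrix_left_right_inverse)
  then show ?thesis
    by (simp add: M_def N_def matrix_matrix_mult_def mat_def vec_eq_iff)
qed

text \<open>Exchanging the two sums exposes the completeness relation of the basis, a Kronecker
  delta that picks out \<open>x $ k\<close>.\<close>

lemma orthonormal_expansion:
  fixes a :: "'n \<Rightarrow> complex ^ 'n"
  assumes "\<And>i j. cinner (a i) (a j) = (if i = j then 1 else 0)"
  shows "x = (\<Sum>i\<in>UNIV. cinner (a i) x *s a i)"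
proof -
  have "(\<Sum>i\<in>UNIV. cinner (a i) x *s a i) $ k = x $ k" for k
  proof -
    have "(\<Sum>i\<in>UNIV. cinner (a i) x *s a i) $ k
        = (\<Sum>i\<in>UNIV. \<Sum>l\<in>UNIV. a i $ k * cnj (a i $ l) * x $ l)"
      by (simp add: cinner_def sum_distrib_left sum_distrib_right mult_ac)
    also have "\<dots> = (\<Sum>l\<in>UNIV. (\<Sum>i\<in>UNIV. a i $ k * cnj (a i $ l)) * x $ l)"
      by (subst sum.swap) (simp add: sum_distrib_right)
    also have "\<dots> = x $ k"
      by (simp add: orthonormal_complete[OF assms] if_distrib[of "\<lambda>z. z * _"] cong: if_cong)
    finally show ?thesis .
  qed
  then show ?thesis by (simp add: vec_eq_iff)
qed

text \<open>The family is indexed by the coordinate type, so it has as many members as the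
  dimension; the expansion of a vector then places it in the span.\<close>

lemma orthonormal_basis_iff:
  fixes a :: "'n \<Rightarrow> complex ^ 'n"
  shows "orthonormal_basis a \<longleftrightarrow> (\<forall>i j. cinner (a i) (a j) = (if i = j then 1 else 0))"
proof
  assume *: "\<forall>i j. cinner (a i) (a j) = (if i = j then 1 else 0)"
  have "x \<in> vec.span (range a)" for x
  proof -
    have "(\<Sum>i\<in>UNIV. cinner (a i) x *s a i) \<in> vec.span (range a)"
      by (intro vec.span_sum vec.span_scale vec.span_base rangeI)
    then show ?thesis
      using * by (simp flip: orthonormal_expansion[of a x])
  qed
  with * show "orthonormal_basis a"
    by (auto simp: orthonormal_basis_def)
qed (simp add: orthonormal_basis_def)

text \<open>Parseval's identity. Only \<open>y\<close> is expanded; Hermitian symmetry then turns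
  \<open>cinner x (a i)\<close> into the conjugate of a coordinate of \<open>x\<close>.\<close>

lemma cinner_coords:
  fixes a :: "'n \<Rightarrow> complex ^ 'n"
  assumes "orthonormal_basis a"
  shows "cinner (coords a x) (coords a y) = cinner x y"
proof -
  have "cinner x y = (\<Sum>k\<in>UNIV. \<Sum>i\<in>UNIV. cnj (x $ k) * (cinner (a i) y * a i $ k))"
    using assms
    by (subst orthonormal_expansion[of a y])
      (auto simp: orthonormal_basis_iff cinner_def[of x] sum_distrib_left)
  also have "\<dots> = (\<Sum>i\<in>UNIV. cinner (a i) y * cinner x (a i))"
    by (subst sum.swap) (simp add: cinner_def[of x] sum_distrib_left mult_ac)
  also have "\<dots> = cinner (coords a x) (coords a y)"
    by (simp add: coords_def cinner_def[of "vec_lambda _"] cinner_commute[of x] mult.commute)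
  finally show ?thesis ..
qed

section \<open>Representing a product state as \<open>ket 0 \<otimes> ket 0\<close>\<close>

lemma orthonormal_basis_pair:
  fixes x y :: "complex ^ 2"
  assumes "cinner x x = 1" "cinner y y = 1" "cinner x y = 0"
  shows "orthonormal_basis (\<lambda>i :: 2. if i = 0 then x else y)"
proof -
  have "cinner y x = 0"
    using assms(3) by (simp add: cinner_commute[of y])
  moreover have "i = 0 \<or> i = 1" for i :: 2
    using UNIV_2' by blast
  ultimately show ?thesis
    unfolding orthonormal_basis_iff using assms by (metis (full_types))
qed

lemma qubit_basis_through:
  fixes u :: "complex ^ 2"
  assumes "u \<noteq> 0"
  obtains a :: "2 \<Rightarrow> complex ^ 2"
  where "orthonormal_basis a" "coords a u = complex_of_real (norm u) *s ket 0"
proof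
  define n where "n = complex_of_real (norm u)"
  define x where "x = (1 / n) *s u"
  \<comment> \<open>Up to a phase, the unit vector orthogonal to \<open>u\<close>: swap the entries,
    conjugate them and change one sign.\<close>
  define y :: "complex ^ 2" where "y = (\<chi> i. if i = 0 then - cnj (u $ 1) / n else cnj (u $ 0) / n)"
  define a where "a = (\<lambda>i :: 2. if i = 0 then x else y)"
  have n: "n \<noteq> 0" "cnj n = n"
    using assms by (simp_all add: n_def)
  have nn: "cnj (u $ 0) * u $ 0 + cnj (u $ 1) * u $ 1 = n * n"
    using cinner_self[of u] by (simp add: cinner_qubit n_def power2_eq_square)
  have "cinner x x = 1" "cinner y y = 1" "cinner x y = 0"
    using n nn by (simp_all add: x_def y_def cinner_qubit field_simps)
  then show "orthonormal_basis a"
    unfolding a_def by (rule orthonormal_basis_pair)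
  have "cinner x u = n" "cinner y u = 0"
    using n nn by (simp_all add: x_def y_def cinner_qubit field_simps)
  then show "coords a u = complex_of_real (norm u) *s ket 0"
    by (simp add: qubit_eq_iff coords_def a_def ket_nth n_def)
qed

lemma product_state_representable:
  assumes "is_state (u \<otimes> v)"
  shows "\<exists>a b. orthonormal_basis a \<and> orthonormal_basis b \<and> local_rep a b (u \<otimes> v) = ket 0 \<otimes> ket 0"
proof -
  have 1: "complex_of_real ((norm u)\<^sup>2 * (norm v)\<^sup>2) = 1"
    using assms unfolding is_state_iff_cinner cinner_tensor by (simp add: cinner_self)
  then have "u \<noteq> 0" "v \<noteq> 0" by auto
  then obtain a b :: "2 \<Rightarrow> complex ^ 2"
    where "orthonormal_basis a" "coords a u = complex_of_real (norm u) *s ket 0"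
      "orthonormal_basis b" "coords b v = complex_of_real (norm v) *s ket 0"
    by (metis qubit_basis_through)
  \<comment> \<open>The coordinate vectors carry the scalars \<open>norm u\<close> and
    \<open>norm v\<close>. A unit product state fixes only their product, which is all that remains
    once both are collected on one factor.\<close>
  moreover have "norm u * norm v = 1"
  proof -
    have "(norm u * norm v)\<^sup>2 = 1"
      using 1 unfolding of_real_eq_1_iff by (simp add: power_mult_distrib)
    then show ?thesis
      by (smt (verit) power2_eq_1_iff mult_nonneg_nonneg norm_ge_zero)
  qed
  then have "complex_of_real (norm u) * complex_of_real (norm v) = 1"
    by (metis of_real_1 of_real_mult)
  ultimately show ?thesis
    by (intro exI[of _ a] exI[of _ b])
      (simp add: local_rep_tensor tensor_scale_swap vec.scale_scale mult.commute)
qed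

section \<open>Completing \<open>ket 0 \<otimes> ket 0\<close> to a triple\<close>

lemma orthogonal_to_first_axis:
  fixes U U' :: "complex ^ 2"
  assumes "cinner U U' = 0" "U $ 0 \<noteq> 0" "U $ 1 = 0"
  shows "U' = U' $ 1 *s ket 1"
  \<comment> \<open>With \<open>U $ 1 = 0\<close> the product is
    \<open>cnj (U $ 0) * U' $ 0\<close>, so \<open>U' $ 0\<close> vanishes and only the
    \<open>ket 1\<close> component is left.\<close>
  using assms by (simp add: cinner_qubit qubit_eq_iff ket_nth)

lemma tensor_eq_ket00:
  assumes "U \<otimes> V = ket 0 \<otimes> ket 0"
  shows "U $ 0 \<noteq> 0" "U $ 1 = 0" "V $ 0 \<noteq> 0" "V $ 1 = 0"
proof -
  have "U $ i * V $ j = ket 0 $ i * ket 0 $ j" for i j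
    using assms by (metis tensor_nth)
  \<comment> \<open>The first entry makes \<open>U $ 0\<close> and \<open>V $ 0\<close> nonzero; the
    two mixed entries then force \<open>V $ 1\<close> and \<open>U $ 1\<close> to vanish.\<close>
  from this[of 0 0] this[of 0 1] this[of 1 0]
  show "U $ 0 \<noteq> 0" "U $ 1 = 0" "V $ 0 \<noteq> 0" "V $ 1 = 0"
    by (auto simp: ket_nth)
qed

text \<open>Both \<open>U'\<close> and \<open>U''\<close> are multiples of \<open>ket 1\<close>.
  Moving their scalars to \<open>B\<close> leaves exactly the unit vector \<open>ket 1\<close> in
  \<open>A\<close>, so normalisation and orthogonality of the two states become those of their
  \<open>B\<close> factors.\<close>

lemma rest_of_triple_left:
  assumes "U \<otimes> V = ket 0 \<otimes> ket 0" "cinner U U' = 0" "cinner U U'' = 0"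
    and "is_state (U' \<otimes> V')" "is_state (U'' \<otimes> V'')" "cinner (U' \<otimes> V') (U'' \<otimes> V'') = 0"
  shows "\<exists>\<beta> :: 2 \<Rightarrow> complex ^ 2. orthonormal_basis \<beta> \<and>
    U' \<otimes> V' = ket 1 \<otimes> \<beta> 0 \<and> U'' \<otimes> V'' = ket 1 \<otimes> \<beta> 1"
proof -
  define x y where "x = U' $ 1 *s V'" and "y = U'' $ 1 *s V''"
  note U = tensor_eq_ket00(1,2)[OF assms(1)]
  have x: "U' \<otimes> V' = ket 1 \<otimes> x"
    unfolding x_def tensor_scale_swap[symmetric]
    using orthogonal_to_first_axis[OF assms(2) U] by simp
  have y: "U'' \<otimes> V'' = ket 1 \<otimes> y"
    unfolding y_def tensor_scale_swap[symmetric]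
    using orthogonal_to_first_axis[OF assms(3) U] by simp
  have "cinner x x = 1" "cinner y y = 1" "cinner x y = 0"
    using assms(4-6) by (simp_all add: x y is_state_iff_cinner cinner_tensor cinner_ket)
  from orthonormal_basis_pair[OF this] show ?thesis
    by (intro exI[of _ "\<lambda>i. if i = 0 then x else y"]) (simp add: x y)
qed

text \<open>The mirror image: the scalars move from \<open>B\<close> to \<open>A\<close>.\<close>

lemma rest_of_triple_right:
  assumes "U \<otimes> V = ket 0 \<otimes> ket 0" "cinner V V' = 0" "cinner V V'' = 0"
    and "is_state (U' \<otimes> V')" "is_state (U'' \<otimes> V'')" "cinner (U' \<otimes> V') (U'' \<otimes> V'') = 0"
  shows "\<exists>\<alpha> :: 2 \<Rightarrow> complex ^ 2. orthonormal_basis \<alpha> \<and>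
    U' \<otimes> V' = \<alpha> 0 \<otimes> ket 1 \<and> U'' \<otimes> V'' = \<alpha> 1 \<otimes> ket 1"
proof -
  define x y where "x = V' $ 1 *s U'" and "y = V'' $ 1 *s U''"
  note V = tensor_eq_ket00(3,4)[OF assms(1)]
  have x: "U' \<otimes> V' = x \<otimes> ket 1"
    unfolding x_def tensor_scale_swap
    using orthogonal_to_first_axis[OF assms(2) V] by simp
  have y: "U'' \<otimes> V'' = y \<otimes> ket 1"
    unfolding y_def tensor_scale_swap
    using orthogonal_to_first_axis[OF assms(3) V] by simp
  have "cinner x x = 1" "cinner y y = 1" "cinner x y = 0"
    using assms(4-6) by (simp_all add: x y is_state_iff_cinner cinner_tensor cinner_ket)
  from orthonormal_basis_pair[OF this] show ?thesis
    by (intro exI[of _ "\<lambda>i. if i = 0 then x else y"]) (simp add: x y)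
qed

text \<open>Both coordinate maps preserve Hermitian products, so every hypothesis passes to the
  represented vectors. Orthogonality through \<open>A\<close> leaves a basis of \<open>B\<close>
  free, and conversely.\<close>

lemma rest_of_triple:
  assumes ab: "orthonormal_basis a" "orthonormal_basis b"
    and rep: "local_rep a b (u \<otimes> v) = ket 0 \<otimes> ket 0"
    and hub: "cinner u u' = 0 \<and> cinner u u'' = 0 \<or> cinner v v' = 0 \<and> cinner v v'' = 0"
    and st: "is_state (u' \<otimes> v')" "is_state (u'' \<otimes> v'')" "cinner (u' \<otimes> v') (u'' \<otimes> v'') = 0"
  shows "(\<exists>\<alpha> :: 2 \<Rightarrow> complex ^ 2. orthonormal_basis \<alpha> \<and>
      local_rep a b (u' \<otimes> v') = \<alpha> 0 \<otimes> ket 1 \<and> local_rep a b (u'' \<otimes> v'') = \<alpha> 1 \<otimes> ket 1) \<or>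
    (\<exists>\<beta> :: 2 \<Rightarrow> complex ^ 2. orthonormal_basis \<beta> \<and>
      local_rep a b (u' \<otimes> v') = ket 1 \<otimes> \<beta> 0 \<and> local_rep a b (u'' \<otimes> v'') = ket 1 \<otimes> \<beta> 1)"
proof -
  let ?A = "coords a" and ?B = "coords b"
  note iso = cinner_coords[OF ab(1)] cinner_coords[OF ab(2)]
  have st': "is_state (?A u' \<otimes> ?B v')" "is_state (?A u'' \<otimes> ?B v'')"
    "cinner (?A u' \<otimes> ?B v') (?A u'' \<otimes> ?B v'') = 0"
    using st by (simp_all add: is_state_iff_cinner cinner_tensor iso)
  have rep': "?A u \<otimes> ?B v = ket 0 \<otimes> ket 0"
    using rep by (simp add: local_rep_tensor)
  from hub show ?thesis
    unfolding local_rep_tensor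
  proof
    assume "cinner u u' = 0 \<and> cinner u u'' = 0"
    then have "cinner (?A u) (?A u') = 0" "cinner (?A u) (?A u'') = 0"
      by (simp_all add: iso)
    from rest_of_triple_left[OF rep' this st']
    show "(\<exists>\<alpha> :: 2 \<Rightarrow> complex ^ 2. orthonormal_basis \<alpha> \<and>
        ?A u' \<otimes> ?B v' = \<alpha> 0 \<otimes> ket 1 \<and> ?A u'' \<otimes> ?B v'' = \<alpha> 1 \<otimes> ket 1) \<or>
      (\<exists>\<beta> :: 2 \<Rightarrow> complex ^ 2. orthonormal_basis \<beta> \<and>
        ?A u' \<otimes> ?B v' = ket 1 \<otimes> \<beta> 0 \<and> ?A u'' \<otimes> ?B v'' = ket 1 \<otimes> \<beta> 1)" ..
  next
    assume "cinner v v' = 0 \<and> cinner v v'' = 0"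
    then have "cinner (?B v) (?B v') = 0" "cinner (?B v) (?B v'') = 0"
      by (simp_all add: iso)
    from rest_of_triple_right[OF rep' this st']
    show "(\<exists>\<alpha> :: 2 \<Rightarrow> complex ^ 2. orthonormal_basis \<alpha> \<and>
        ?A u' \<otimes> ?B v' = \<alpha> 0 \<otimes> ket 1 \<and> ?A u'' \<otimes> ?B v'' = \<alpha> 1 \<otimes> ket 1) \<or>
      (\<exists>\<beta> :: 2 \<Rightarrow> complex ^ 2. orthonormal_basis \<beta> \<and>
        ?A u' \<otimes> ?B v' = ket 1 \<otimes> \<beta> 0 \<and> ?A u'' \<otimes> ?B v'' = ket 1 \<otimes> \<beta> 1)" ..
  qed
qed

section \<open>A state orthogonal to both others through one subsystem\<close>

lemma orthogonal_product_triple_hub: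
  assumes "orthogonal_product_states S" "card S = 3"
  obtains u v u' v' u'' v''
  where "S = {u \<otimes> v, u' \<otimes> v', u'' \<otimes> v''}" "cinner (u' \<otimes> v') (u'' \<otimes> v'') = 0"
    "cinner u u' = 0 \<and> cinner u u'' = 0 \<or> cinner v v' = 0 \<and> cinner v v'' = 0"
proof -
  obtain P Q R where S: "S = {P, Q, R}" and ne: "P \<noteq> Q" "Q \<noteq> R" "P \<noteq> R"
    using assms(2) by (auto simp: card_3_iff)
  have "is_product P" "is_product Q" "is_product R"
    using assms(1) by (auto simp: orthogonal_product_states_def S)
  then obtain p p' q q' r r' where PQR: "P = p \<otimes> p'" "Q = q \<otimes> q'" "R = r \<otimes> r'"
    unfolding is_product_def by blast
  have orth: "cinner P Q = 0" "cinner Q P = 0" "cinner P R = 0" "cinner R P = 0"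
    "cinner Q R = 0" "cinner R Q = 0"
    using assms(1) ne by (auto simp: orthogonal_product_states_def S pairwise_def)
  have sym: "cinner y x = 0" if "cinner x y = 0" for x y :: "complex ^ 2"
    using that by (simp add: cinner_commute[of y])
  have "cinner p q = 0 \<or> cinner p' q' = 0" "cinner p r = 0 \<or> cinner p' r' = 0"
    "cinner q r = 0 \<or> cinner q' r' = 0"
    using orth by (auto simp: PQR cinner_tensor)
  \<comment> \<open>The combinations of alternatives are sorted by the state that the two like pairs
    share; \<open>sym\<close> supplies products in the reverse order.\<close>
  then consider
      "cinner p q = 0 \<and> cinner p r = 0 \<or> cinner p' q' = 0 \<and> cinner p' r' = 0"
    | "cinner q p = 0 \<and> cinner q r = 0 \<or> cinner q' p' = 0 \<and> cinner q' r' = 0"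
    | "cinner r p = 0 \<and> cinner r q = 0 \<or> cinner r' p' = 0 \<and> cinner r' q' = 0"
    using sym by blast
  then show thesis
  proof cases
    case 1
    then show thesis using that[of p p' q q' r r'] orth by (simp add: S PQR)
  next
    case 2
    then show thesis using that[of q q' p p' r r'] orth by (simp add: S PQR insert_commute)
  next
    case 3
    then show thesis using that[of r r' p p' q q'] orth by (simp add: S PQR insert_commute)
  qed
qed

text \<open>For the two families built from an arbitrary basis. Reverse products vanish by Hermitian
  symmetry, and a coincidence of two members would make one product both 1 and 0.\<close>

lemma orthogonal_product_tripleI:
  assumes "is_product P" "is_product Q" "is_product R"
    and "cinner P P = 1" "cinner Q Q = 1" "cinner R R = 1"
    and "cinner P Q = 0" "cinner P R = 0" "cinner Q R = 0"
  shows "orthogonal_product_states {P, Q, R} \<and> card {P, Q, R} = 3"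
proof -
  have "cinner Q P = 0" "cinner R P = 0" "cinner R Q = 0"
    using assms(7-9) by (simp_all add: cinner_commute[of R] cinner_commute[of Q P])
  moreover have "P \<noteq> Q" "P \<noteq> R" "Q \<noteq> R"
    using assms(4-9) by auto
  ultimately show ?thesis
    using assms by (auto simp: orthogonal_product_states_def is_state_iff_cinner pairwise_def)
qed

text \<open>The labelling may depend on the triple but not on the local bases, whereas the resulting
  basis of \<open>A\<close> or \<open>B\<close> may depend on both. The last two conjuncts make
  "arbitrary" precise: every orthonormal basis occurs.\<close>

theorem proposition9:
  shows "(\<forall>S. orthogonal_product_states S \<and> card S = 3 \<longrightarrow>
      (\<exists>Ppp pPp ppP. S = {Ppp, pPp, ppP} \<and>
        (\<exists>a b. orthonormal_basis a \<and> orthonormal_basis b \<and> local_rep a b Ppp = ket 0 \<otimes> ket 0) \<and>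
        (\<forall>a b. orthonormal_basis a \<and> orthonormal_basis b \<and> local_rep a b Ppp = ket 0 \<otimes> ket 0 \<longrightarrow>
          (\<exists>\<alpha> :: 2 \<Rightarrow> complex ^ 2. orthonormal_basis \<alpha> \<and>
            local_rep a b pPp = \<alpha> 0 \<otimes> ket 1 \<and> local_rep a b ppP = \<alpha> 1 \<otimes> ket 1) \<or>
          (\<exists>\<beta> :: 2 \<Rightarrow> complex ^ 2. orthonormal_basis \<beta> \<and>
            local_rep a b pPp = ket 1 \<otimes> \<beta> 0 \<and> local_rep a b ppP = ket 1 \<otimes> \<beta> 1))))
    \<and> (\<forall>\<alpha> :: 2 \<Rightarrow> complex ^ 2. orthonormal_basis \<alpha> \<longrightarrow>
      (let S = {ket 0 \<otimes> ket 0, \<alpha> 0 \<otimes> ket 1, \<alpha> 1 \<otimes> ket 1} in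
        orthogonal_product_states S \<and> card S = 3))
    \<and> (\<forall>\<beta> :: 2 \<Rightarrow> complex ^ 2. orthonormal_basis \<beta> \<longrightarrow>
      (let S = {ket 0 \<otimes> ket 0, ket 1 \<otimes> \<beta> 0, ket 1 \<otimes> \<beta> 1} in
        orthogonal_product_states S \<and> card S = 3))"
proof (intro conjI allI impI)
  fix S :: "(complex ^ (2 \<times> 2)) set"
  assume S: "orthogonal_product_states S \<and> card S = 3"
  then obtain u v u' v' u'' v'' where
    eq: "S = {u \<otimes> v, u' \<otimes> v', u'' \<otimes> v''}" and
    orth: "cinner (u' \<otimes> v') (u'' \<otimes> v'') = 0" and
    hub: "cinner u u' = 0 \<and> cinner u u'' = 0 \<or> cinner v v' = 0 \<and> cinner v v'' = 0"
    using orthogonal_product_triple_hub by metis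
  have st: "is_state (u \<otimes> v)" "is_state (u' \<otimes> v')" "is_state (u'' \<otimes> v'')"
    using S by (auto simp: orthogonal_product_states_def eq)
  show "\<exists>Ppp pPp ppP. S = {Ppp, pPp, ppP} \<and>
        (\<exists>a b. orthonormal_basis a \<and> orthonormal_basis b \<and> local_rep a b Ppp = ket 0 \<otimes> ket 0) \<and>
        (\<forall>a b. orthonormal_basis a \<and> orthonormal_basis b \<and> local_rep a b Ppp = ket 0 \<otimes> ket 0 \<longrightarrow>
          (\<exists>\<alpha> :: 2 \<Rightarrow> complex ^ 2. orthonormal_basis \<alpha> \<and>
            local_rep a b pPp = \<alpha> 0 \<otimes> ket 1 \<and> local_rep a b ppP = \<alpha> 1 \<otimes> ket 1) \<or>
          (\<exists>\<beta> :: 2 \<Rightarrow> complex ^ 2. orthonormal_basis \<beta> \<and>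
            local_rep a b pPp = ket 1 \<otimes> \<beta> 0 \<and> local_rep a b ppP = ket 1 \<otimes> \<beta> 1))"
    \<comment> \<open>The shared state was found from the triple alone, so the same witnesses serve
      all \<open>a\<close> and \<open>b\<close>.\<close>
    by (rule exI[of _ "u \<otimes> v"], rule exI[of _ "u' \<otimes> v'"], rule exI[of _ "u'' \<otimes> v''"],
        intro conjI allI impI eq product_state_representable st(1))
      (elim conjE, rule rest_of_triple[OF _ _ _ hub st(2,3) orth])
next
  fix \<alpha> :: "2 \<Rightarrow> complex ^ 2"
  assume "orthonormal_basis \<alpha>"
  \<comment> \<open>The \<open>B\<close> factors make the first state orthogonal to the other two,
    and the basis in \<open>A\<close> makes these orthogonal to each other.\<close>
  then show "let S = {ket 0 \<otimes> ket 0, \<alpha> 0 \<otimes> ket 1, \<alpha> 1 \<otimes> ket 1} in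
        orthogonal_product_states S \<and> card S = 3"
    unfolding Let_def
    by (intro orthogonal_product_tripleI)
      (auto simp: orthonormal_basis_iff is_product_def cinner_tensor cinner_ket)
next
  fix \<beta> :: "2 \<Rightarrow> complex ^ 2"
  assume "orthonormal_basis \<beta>"
  then show "let S = {ket 0 \<otimes> ket 0, ket 1 \<otimes> \<beta> 0, ket 1 \<otimes> \<beta> 1} in
        orthogonal_product_states S \<and> card S = 3"
    unfolding Let_def
    by (intro orthogonal_product_tripleI)
      (auto simp: orthonormal_basis_iff is_product_def cinner_tensor cinner_ket)
qed

end
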